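(* Let $X_1,X_2$ be complex Banach spaces, $X=X_1\times X_2$, and let $\mathcal A$ be a block operator matrix on $X$ with dense domain. Then $\mathcal A^\times=\mathcal A^*$ (equality of linear operators on $X_1^*\times X_2^*$, including equality of domains) if and only if $\mathcal A^*$ has a matrix representation.
   Context: All operators are linear and possibly unbounded, defined on linear subspaces; $\mathcal D(T)$ denotes the domain of $T$. $X=X_1\times X_2$ carries the norm $\|(x_1\ x_2)^t\|=(\|x_1\|^2+\|x_2\|^2)^{1/2}$. $X_k^*$ denotes the adjoint space of $X_k$ (in the sense of Kato), with pairing $(f,x)$. The space $X^*$ is identified with $X_1^*\times X_2^*$ via $(f,x)=(f_1,x_1)+(f_2,x_2)$ for $f=(f_1\ f_2)^t$, $x=(x_1\ x_2)^t$. For a densely defined operator $T$ from $X$ to $Y$, the adjoint $T^*$ is the operator from $Y^*$ to $X^*$ whose domain consists of all $g\in Y^*$ for which there is $f\in X^*$ with $(g,Tx)=(f,x)$ for all $x\in\mathcal D(T)$, and then $T^*g=f$. Block operator matrix: given linear operators $A_{jk}:\mathcal D(A_{jk})\subset Z_k\to Z_j$, $j,k=1,2$, the matrix $(A_{jk})$ is called a block operator matrix on $Z_1\times Z_2$, and is identified with the linear operator with domain $(\mathcal D(A_{11})\cap\mathcal D(A_{21}))\times(\mathcal D(A_{12})\cap\mathcal D(A_{22}))$ and action $(x_1\ x_2)^t\mapsto(A_{11}x_1+A_{12}x_2\ \ A_{21}x_1+A_{22}x_2)^t$. A linear operator on $Z_1\times Z_2$ has a matrix representation if it equals (with the same domain)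 the operator induced by some block operator matrix on $Z_1\times Z_2$; for $\mathcal A^*$ this is understood on $X_1^*\times X_2^*$. Formal adjoint: if $\mathcal A=\begin{pmatrix}A&B\\C&D\end{pmatrix}$ has dense domain $\mathcal D_1\times\mathcal D_2$ (so $\mathcal D_1=\mathcal D(A)\cap\mathcal D(C)$, $\mathcal D_2=\mathcal D(B)\cap\mathcal D(D)$), then $$\mathcal A^\times:=\begin{pmatrix}(A|_{\mathcal D_1})^*&(C|_{\mathcal D_1})^*\\(B|_{\mathcal D_2})^*&(D|_{\mathcal D_2})^*\end{pmatrix},$$ a block operator matrix on $X_1^*\times X_2^*$. *)

theory Defs
  imports "HOL-Analysis.Analysis"
begin

section \<open>Complex normed and Banach spaces\<close>

text \<open>The real structure (norm, topology, real scalar multiplication) is the one of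
  \<^class>\<open>real_normed_vector\<close>; complex scalar multiplication extends the real one.\<close>

class complex_normed_vector = real_normed_vector +
  fixes scaleC :: "complex \<Rightarrow> 'a \<Rightarrow> 'a" (infixr "*\<^sub>C" 75)
  assumes scaleC_add_right: "c *\<^sub>C (x + y) = c *\<^sub>C x + c *\<^sub>C y"
    and scaleC_add_left: "(c + d) *\<^sub>C x = c *\<^sub>C x + d *\<^sub>C x"
    and scaleC_scaleC: "c *\<^sub>C d *\<^sub>C x = (c * d) *\<^sub>C x"
    and scaleC_one: "1 *\<^sub>C x = x"
    and scaleR_scaleC: "r *\<^sub>R x = complex_of_real r *\<^sub>C x"
    and norm_scaleC: "norm (c *\<^sub>C x) = cmod c * norm x"

class complex_banach = complex_normed_vector + banach

global_interpretation complex_vector: vector_space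
  "scaleC :: complex \<Rightarrow> 'a \<Rightarrow> 'a::complex_normed_vector"
  by unfold_locales (rule scaleC_add_right scaleC_add_left scaleC_scaleC scaleC_one)+

instantiation prod :: (complex_normed_vector, complex_normed_vector) complex_normed_vector
begin

definition scaleC_prod :: "complex \<Rightarrow> 'a \<times> 'b \<Rightarrow> 'a \<times> 'b" where
  "scaleC_prod c x = (c *\<^sub>C fst x, c *\<^sub>C snd x)"

instance
proof
  fix c d :: complex and x y :: "'a \<times> 'b" and r :: real
  show "norm (c *\<^sub>C x) = cmod c * norm x"
    by (simp add: scaleC_prod_def norm_prod_def norm_scaleC power_mult_distrib
        real_sqrt_mult flip: distrib_left)
qed (auto simp: scaleC_prod_def scaleC_add_right scaleC_add_left scaleC_scaleC scaleC_one
    scaleR_prod_def scaleR_scaleC)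

end

section \<open>The adjoint space in the sense of Kato\<close>

text \<open>The adjoint space consists of the bounded \<^emph>\<open>semilinear\<close> (conjugate-linear) forms, so that
  the pairing \<open>(f, x)\<close> is linear in \<open>f\<close> and semilinear in \<open>x\<close>. A bounded semilinear form
  is in particular a bounded real-linear map into the complex numbers, from which the linear
  structure and the norm are inherited.\<close>

typedef (overloaded) 'a adj =
  "{f :: 'a::complex_normed_vector \<Rightarrow>\<^sub>L complex. \<forall>c x. f (c *\<^sub>C x) = cnj c * f x}"
  by (rule exI[of _ 0]) simp

setup_lifting type_definition_adj

lift_definition pairing :: "'a::complex_normed_vector adj \<Rightarrow> 'a \<Rightarrow> complex" is blinfun_apply .

instantiation adj :: (complex_normed_vector) complex_normed_vector
begin

lift_definition zero_adj :: "'a adj" is 0 by simp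
lift_definition plus_adj :: "'a adj \<Rightarrow> 'a adj \<Rightarrow> 'a adj" is "(+)"
  by (simp add: plus_blinfun.rep_eq distrib_left)
lift_definition minus_adj :: "'a adj \<Rightarrow> 'a adj \<Rightarrow> 'a adj" is "(-)"
  by (simp add: minus_blinfun.rep_eq right_diff_distrib)
lift_definition uminus_adj :: "'a adj \<Rightarrow> 'a adj" is uminus
  by (simp add: uminus_blinfun.rep_eq)
lift_definition scaleR_adj :: "real \<Rightarrow> 'a adj \<Rightarrow> 'a adj" is "(*\<^sub>R)"
  by (simp add: scaleR_blinfun.rep_eq)
lift_definition scaleC_adj :: "complex \<Rightarrow> 'a adj \<Rightarrow> 'a adj"
  is "\<lambda>c f. blinfun_mult_right c o\<^sub>L f"
  by simp
lift_definition norm_adj :: "'a adj \<Rightarrow> real" is norm .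

definition sgn_adj :: "'a adj \<Rightarrow> 'a adj" where
  "sgn_adj f = inverse (norm f) *\<^sub>R f"
definition dist_adj :: "'a adj \<Rightarrow> 'a adj \<Rightarrow> real" where
  "dist_adj f g = norm (f - g)"
definition uniformity_adj :: "('a adj \<times> 'a adj) filter" where
  "uniformity_adj = (INF e\<in>{0<..}. principal {(x, y). dist x y < e})"
definition open_adj :: "'a adj set \<Rightarrow> bool" where
  "open_adj U \<longleftrightarrow> (\<forall>x\<in>U. \<forall>\<^sub>F (x', y) in uniformity. x' = x \<longrightarrow> y \<in> U)"

instance
proof
  fix c d :: complex and f g h :: "'a adj" and a b :: real and U :: "'a adj set"
  show "f + g + h = f + (g + h)" by transfer simp
  show "f + g = g + f" by transfer simp
  show "0 + f = f" by transfer simp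
  show "- f + f = 0" by transfer simp
  show "f - g = f + - g" by transfer simp
  show "a *\<^sub>R (f + g) = a *\<^sub>R f + a *\<^sub>R g" by transfer (simp add: scaleR_add_right)
  show "(a + b) *\<^sub>R f = a *\<^sub>R f + b *\<^sub>R f" by transfer (simp add: scaleR_add_left)
  show "a *\<^sub>R b *\<^sub>R f = (a * b) *\<^sub>R f" by transfer simp
  show "1 *\<^sub>R f = f" by transfer simp
  show "sgn f = inverse (norm f) *\<^sub>R f" by (rule sgn_adj_def)
  show "dist f g = norm (f - g)" by (rule dist_adj_def)
  show "(uniformity :: ('a adj \<times> 'a adj) filter)
      = (INF e\<in>{0<..}. principal {(x, y). dist x y < e})" by (rule uniformity_adj_def)
  show "open U \<longleftrightarrow> (\<forall>x\<in>U. \<forall>\<^sub>F (x', y) in uniformity. x' = x \<longrightarrow> y \<in> U)"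
    by (rule open_adj_def)
  show "norm f = 0 \<longleftrightarrow> f = 0" by transfer simp
  show "norm (f + g) \<le> norm f + norm g" by transfer (rule norm_triangle_ineq)
  show "norm (a *\<^sub>R f) = \<bar>a\<bar> * norm f" by transfer simp
  show "c *\<^sub>C (f + g) = c *\<^sub>C f + c *\<^sub>C g"
    by transfer (auto intro!: blinfun_eqI simp: plus_blinfun.rep_eq distrib_left)
  show "(c + d) *\<^sub>C f = c *\<^sub>C f + d *\<^sub>C f"
    by transfer (auto intro!: blinfun_eqI simp: plus_blinfun.rep_eq distrib_right)
  show "c *\<^sub>C d *\<^sub>C f = (c * d) *\<^sub>C f"
    by transfer (auto intro!: blinfun_eqI)
  show "1 *\<^sub>C f = f"
    by transfer (auto intro!: blinfun_eqI)
  show "a *\<^sub>R f = complex_of_real a *\<^sub>C f"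
    by transfer (auto intro!: blinfun_eqI simp: scaleR_blinfun.rep_eq scaleR_conv_of_real)
  show "norm (c *\<^sub>C f) = cmod c * norm f"
  proof transfer
    fix c and f :: "'a \<Rightarrow>\<^sub>L complex"
    have le: "norm (blinfun_mult_right c o\<^sub>L f) \<le> cmod c * norm f" for c and f :: "'a \<Rightarrow>\<^sub>L complex"
      by (rule norm_blinfun_bound)
        (auto simp: norm_mult mult.assoc intro!: mult_left_mono norm_blinfun)
    show "norm (blinfun_mult_right c o\<^sub>L f) = cmod c * norm f"
    proof (cases "c = 0")
      case True
      then show ?thesis using le[of c f] by simp
    next
      case False
      have "f = blinfun_mult_right (inverse c) o\<^sub>L (blinfun_mult_right c o\<^sub>L f)"
        using False by (auto intro!: blinfun_eqI)
      then have "norm f \<le> cmod (inverse c) * norm (blinfun_mult_right c o\<^sub>L f)"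
        using le[of "inverse c" "blinfun_mult_right c o\<^sub>L f"] by simp
      then have "cmod c * norm f \<le> norm (blinfun_mult_right c o\<^sub>L f)"
        using False by (simp add: norm_divide norm_inverse field_simps)
      then show ?thesis using le[of c f] by simp
    qed
  qed
qed

end

lemma pairing_add_left: "pairing (f + g) x = pairing f x + pairing g x"
  by transfer (simp add: plus_blinfun.rep_eq)

lemma pairing_scaleC_left: "pairing (c *\<^sub>C f) x = c * pairing f x"
  by transfer simp

lemma pairing_add_right: "pairing f (x + y) = pairing f x + pairing f y"
  by transfer (simp add: blinfun.add_right)

lemma pairing_scaleC_right: "pairing f (c *\<^sub>C x) = cnj c * pairing f x"
  by transfer simp

lemma pairing_zero_right: "pairing f 0 = 0"
  by transfer (simp add: blinfun.zero_right)

lemma adj_eqI: "(\<And>x. pairing f x = pairing g x) \<Longrightarrow> f = g"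
  by transfer (rule blinfun_eqI)

lemma ex_adj_iff:
  "(\<exists>f. pairing f = \<phi>) \<longleftrightarrow>
    bounded_linear \<phi> \<and> (\<forall>c x. \<phi> (c *\<^sub>C x) = cnj c * \<phi> x)"
proof
  assume "\<exists>f. pairing f = \<phi>"
  then show "bounded_linear \<phi> \<and> (\<forall>c x. \<phi> (c *\<^sub>C x) = cnj c * \<phi> x)"
    by (metis pairing.rep_eq blinfun.bounded_linear_right pairing_scaleC_right)
next
  assume *: "bounded_linear \<phi> \<and> (\<forall>c x. \<phi> (c *\<^sub>C x) = cnj c * \<phi> x)"
  then have "pairing (Abs_adj (Blinfun \<phi>)) = \<phi>"
    by (simp add: pairing.rep_eq Abs_adj_inverse bounded_linear_Blinfun_apply)
  then show "\<exists>f. pairing f = \<phi>" ..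
qed

text \<open>The identification of \<open>X\<^sub>1\<^sup>* \<times> X\<^sub>2\<^sup>*\<close> with \<open>(X\<^sub>1 \<times> X\<^sub>2)\<^sup>*\<close>; see \<open>pairing_adj_pair\<close> and
  \<open>bij_adj_pair\<close> below.\<close>

lift_definition adj_pair' ::
    "'a::complex_normed_vector adj \<Rightarrow> 'b::complex_normed_vector adj \<Rightarrow> ('a \<times> 'b) adj"
  is "\<lambda>f g. (f o\<^sub>L fst_blinfun) + (g o\<^sub>L snd_blinfun)"
  by (simp add: plus_blinfun.rep_eq scaleC_prod_def distrib_left)

definition adj_pair ::
    "'a::complex_normed_vector adj \<times> 'b::complex_normed_vector adj \<Rightarrow> ('a \<times> 'b) adj"
  where "adj_pair f = adj_pair' (fst f) (snd f)"

lemma pairing_adj_pair: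
  "pairing (adj_pair f) x = pairing (fst f) (fst x) + pairing (snd f) (snd x)"
  unfolding adj_pair_def by transfer (simp add: plus_blinfun.rep_eq)

lemma bij_adj_pair:
  "bij (adj_pair :: 'a::complex_normed_vector adj \<times> 'b::complex_normed_vector adj \<Rightarrow> ('a \<times> 'b) adj)"
  (is "bij ?F")
proof (rule bijI)
  show "inj ?F"
  proof (rule injI)
    fix f g :: "'a adj \<times> 'b adj"
    assume "adj_pair f = adj_pair g"
    then have *: "pairing (fst f) x + pairing (snd f) y = pairing (fst g) x + pairing (snd g) y"
      for x y by (metis pairing_adj_pair fst_conv snd_conv)
    show "f = g"
      using *[of _ 0] *[of 0] by (auto intro!: prod_eqI adj_eqI simp: pairing_zero_right)
  qed
  show "surj ?F"
    unfolding surj_def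
  proof (rule allI)
    fix h :: "('a \<times> 'b) adj"
    have h: "bounded_linear (pairing h)" using ex_adj_iff by blast
    have "bounded_linear (\<lambda>x. pairing h (x, 0))"
      by (rule bounded_linear_compose[OF h]) (intro bounded_linear_intros)
    then obtain f where f: "pairing f = (\<lambda>x. pairing h (x, 0))"
      using ex_adj_iff[of "\<lambda>x. pairing h (x, 0)"]
        pairing_scaleC_right[of h _ "(_, 0)"] by (auto simp: scaleC_prod_def)
    have "bounded_linear (\<lambda>y. pairing h (0, y))"
      by (rule bounded_linear_compose[OF h]) (intro bounded_linear_intros)
    then obtain g where g: "pairing g = (\<lambda>y. pairing h (0, y))"
      using ex_adj_iff[of "\<lambda>y. pairing h (0, y)"]
        pairing_scaleC_right[of h _ "(0, _)"] by (auto simp: scaleC_prod_def)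
    have "h = adj_pair (f, g)"
      by (rule adj_eqI) (simp add: pairing_adj_pair f g flip: pairing_add_right)
    then show "\<exists>f. h = adj_pair f" by blast
  qed
qed

section \<open>Unbounded operators\<close>

text \<open>A possibly unbounded operator \<open>T\<close> is a partial function with \<open>dom T\<close> as its domain, so
  that equality of operators includes equality of domains and \<open>T |` S\<close> is the restriction
  of \<open>T\<close> to \<open>S\<close>.\<close>

definition linear_operator ::
    "('a::complex_normed_vector \<rightharpoonup> 'b::complex_normed_vector) \<Rightarrow> bool" where
  "linear_operator T \<longleftrightarrow> complex_vector.subspace (dom T) \<and>
    (\<forall>x\<in>dom T. \<forall>y\<in>dom T. the (T (x + y)) = the (T x) + the (T y)) \<and>
    (\<forall>c. \<forall>x\<in>dom T. the (T (c *\<^sub>C x)) = c *\<^sub>C the (T x))"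

definition densely_defined ::
    "('a::complex_normed_vector \<rightharpoonup> 'b::complex_normed_vector) \<Rightarrow> bool" where
  "densely_defined T \<longleftrightarrow> closure (dom T) = UNIV"

definition adjoint_rel ::
    "('a::complex_normed_vector \<rightharpoonup> 'b::complex_normed_vector) \<Rightarrow> 'b adj \<Rightarrow> 'a adj \<Rightarrow> bool" where
  "adjoint_rel T g f \<longleftrightarrow> (\<forall>x\<in>dom T. pairing g (the (T x)) = pairing f x)"

text \<open>Meaningful for densely defined \<open>T\<close> only, where \<open>f\<close> is unique
  (see \<open>adjoint_rel_unique\<close>).\<close>

definition adjoint ::
    "('a::complex_normed_vector \<rightharpoonup> 'b::complex_normed_vector) \<Rightarrow> ('b adj \<rightharpoonup> 'a adj)" where
  "adjoint T g = (if \<exists>f. adjoint_rel T g f then Some (THE f. adjoint_rel T g f) else None)"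

lemma adjoint_rel_unique:
  assumes "densely_defined T" "adjoint_rel T g f" "adjoint_rel T g f'"
  shows "f = f'"
proof (rule adj_eqI)
  fix x
  have "bounded_linear (pairing f)" "bounded_linear (pairing f')" using ex_adj_iff by blast+
  then have "continuous_on (closure (dom T)) (\<lambda>x. pairing f x - pairing f' x)"
    by (intro continuous_intros linear_continuous_on)
  moreover have "pairing f y - pairing f' y = 0" if "y \<in> dom T" for y
    using assms(2,3) that by (simp add: adjoint_rel_def)
  ultimately have "pairing f x - pairing f' x = 0"
    using continuous_constant_on_closure[of "dom T" "\<lambda>x. pairing f x - pairing f' x" 0 x]
      assms(1) by (simp add: densely_defined_def)
  then show "pairing f x = pairing f' x" by simp
qed

section \<open>Block operator matrices\<close>

definition block_op ::
    "('a::complex_normed_vector \<rightharpoonup> 'a) \<Rightarrow> ('b::complex_normed_vector \<rightharpoonup> 'a) \<Rightarrow>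
     ('a \<rightharpoonup> 'b) \<Rightarrow> ('b \<rightharpoonup> 'b) \<Rightarrow> ('a \<times> 'b \<rightharpoonup> 'a \<times> 'b)" where
  "block_op A B C D = (\<lambda>(x, y).
     if x \<in> dom A \<inter> dom C \<and> y \<in> dom B \<inter> dom D
     then Some (the (A x) + the (B y), the (C x) + the (D y)) else None)"

definition has_matrix_representation ::
    "('a::complex_normed_vector \<times> 'b::complex_normed_vector \<rightharpoonup> 'a \<times> 'b) \<Rightarrow> bool" where
  "has_matrix_representation T \<longleftrightarrow>
    (\<exists>A B C D. linear_operator A \<and> linear_operator B \<and> linear_operator C \<and> linear_operator D \<and>
       T = block_op A B C D)"

text \<open>The adjoint of an operator on \<open>X\<^sub>1 \<times> X\<^sub>2\<close>, regarded as an operator on \<open>X\<^sub>1\<^sup>* \<times> X\<^sub>2\<^sup>*\<close>.\<close>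

definition adjoint_prod ::
    "('a::complex_normed_vector \<times> 'b::complex_normed_vector \<rightharpoonup> 'a \<times> 'b) \<Rightarrow>
     ('a adj \<times> 'b adj \<rightharpoonup> 'a adj \<times> 'b adj)" where
  "adjoint_prod T g = map_option (inv adj_pair) (adjoint T (adj_pair g))"

definition formal_adjoint ::
    "('a::complex_normed_vector \<rightharpoonup> 'a) \<Rightarrow> ('b::complex_normed_vector \<rightharpoonup> 'a) \<Rightarrow>
     ('a \<rightharpoonup> 'b) \<Rightarrow> ('b \<rightharpoonup> 'b) \<Rightarrow> ('a adj \<times> 'b adj \<rightharpoonup> 'a adj \<times> 'b adj)" where
  "formal_adjoint A B C D =
    (let D1 = dom A \<inter> dom C; D2 = dom B \<inter> dom D
     in block_op (adjoint (A |` D1)) (adjoint (C |` D1))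
                 (adjoint (B |` D2)) (adjoint (D |` D2)))"

end

(* The inclusion of the formal adjoint in the adjoint always holds. Testing the defining identity of
   the adjoint on (x, 0) and (0, y) splits it into one identity per column. The domain of a block
   operator matrix is a product, so if the adjoint has a matrix representation and (g1, g2) lies in
   its domain, then so do (g1, 0) and (0, g2); for these vectors the column identities say that g1
   and g2 lie in the domains of the adjoints of the individual entries. *)

theory Submission
  imports Defs
begin

lemma linear_operator_zero:
  assumes "linear_operator T"
  shows "T 0 = Some 0"
proof -
  have 0: "0 \<in> dom T"
    using assms complex_vector.subspace_0 by (auto simp: linear_operator_def)
  then have "the (T (0 *\<^sub>C 0)) = 0 *\<^sub>C the (T 0)"
    using assms unfolding linear_operator_def by blast
  then show ?thesis
    using 0 by auto
qed

text \<open>Density makes the value unique, so \<open>THE\<close> returns any \<open>f\<close>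
  satisfying the relation. From here on adjoints are handled through \<open>adjoint_rel\<close>
  alone.\<close>

lemma adjoint_eq_Some_iff:
  assumes "densely_defined T"
  shows "adjoint T g = Some f \<longleftrightarrow> adjoint_rel T g f"
proof -
  have "(THE f. adjoint_rel T g f) = f" if "adjoint_rel T g f" for f
    using that adjoint_rel_unique[OF assms] by blast
  then show ?thesis
    by (auto simp: adjoint_def)
qed

text \<open>Linearity phrased through \<open>Some\<close>-equations, the form in which
  \<open>adjoint_eq_Some_iff\<close> describes an adjoint.\<close>

lemma linear_operatorI:
  assumes "T 0 = Some 0"
    and "\<And>x y u v. T x = Some u \<Longrightarrow> T y = Some v \<Longrightarrow> T (x + y) = Some (u + v)"
    and "\<And>c x u. T x = Some u \<Longrightarrow> T (c *\<^sub>C x) = Some (c *\<^sub>C u)"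
  shows "linear_operator T"
  unfolding linear_operator_def complex_vector.subspace_def
  using assms by (fastforce simp: dom_def)

lemma pairing_zero_left: "pairing 0 x = 0"
  by transfer simp

text \<open>The pairing is linear in its left argument, so the pairs \<open>(g, f)\<close>
  satisfying the adjoint relation form a subspace.\<close>

lemma linear_operator_adjoint:
  assumes "densely_defined T"
  shows "linear_operator (adjoint T)"
  by (rule linear_operatorI; simp add: adjoint_eq_Some_iff[OF assms] adjoint_rel_def
      pairing_zero_left pairing_add_left pairing_scaleC_left)

lemma adjoint_prod_eq_Some_iff:
  assumes "densely_defined T"
  shows "adjoint_prod T g = Some f \<longleftrightarrow> adjoint_rel T (adj_pair g) (adj_pair f)"
proof -
  have "inv adj_pair h = f \<longleftrightarrow> h = adj_pair f" for h
    using bij_adj_pair bij_inv_eq_iff by metis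
  then show ?thesis
    by (auto simp: adjoint_prod_def adjoint_eq_Some_iff[OF assms])
qed

lemma dom_block_op: "dom (block_op A B C D) = (dom A \<inter> dom C) \<times> (dom B \<inter> dom D)"
  by (auto simp: block_op_def split: if_splits)

lemma block_op_eq_Some_iff:
  "block_op A B C D (x, y) = Some z \<longleftrightarrow>
    (\<exists>a b c d. A x = Some a \<and> B y = Some b \<and> C x = Some c \<and> D y = Some d \<and> z = (a + b, c + d))"
  by (auto simp: block_op_def)

lemma has_matrix_representation_block_op:
  assumes "linear_operator A" "linear_operator B" "linear_operator C" "linear_operator D"
  shows "has_matrix_representation (block_op A B C D)"
  unfolding has_matrix_representation_def using assms by metis

text \<open>Linear entries are defined at 0 with value 0, so either component of a test vector can
  be set to 0. Conversely, the two column identities add up to the full one.\<close>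

lemma adjoint_rel_block_op_iff:
  assumes "linear_operator A" "linear_operator B" "linear_operator C" "linear_operator D"
  shows "adjoint_rel (block_op A B C D) (adj_pair (g1, g2)) (adj_pair (f1, f2)) \<longleftrightarrow>
    (\<forall>x\<in>dom A \<inter> dom C. pairing g1 (the (A x)) + pairing g2 (the (C x)) = pairing f1 x) \<and>
    (\<forall>y\<in>dom B \<inter> dom D. pairing g1 (the (B y)) + pairing g2 (the (D y)) = pairing f2 y)"
    (is "?L \<longleftrightarrow> ?R")
proof -
  note zero = assms[THEN linear_operator_zero]
  have L: "?L \<longleftrightarrow> (\<forall>x\<in>dom A \<inter> dom C. \<forall>y\<in>dom B \<inter> dom D.
      pairing g1 (the (A x)) + pairing g1 (the (B y)) +
      (pairing g2 (the (C x)) + pairing g2 (the (D y))) = pairing f1 x + pairing f2 y)"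
    (is "_ \<longleftrightarrow> ?M")
    unfolding adjoint_rel_def dom_block_op
    by (auto simp: block_op_def pairing_adj_pair pairing_add_right)
  have "?R" if M: ?M
  proof (intro conjI ballI)
    fix x assume "x \<in> dom A \<inter> dom C"
    with M[rule_format, of x 0] zero
    show "pairing g1 (the (A x)) + pairing g2 (the (C x)) = pairing f1 x"
      by (simp add: pairing_zero_right domIff)
  next
    fix y assume "y \<in> dom B \<inter> dom D"
    with M[rule_format, of 0 y] zero
    show "pairing g1 (the (B y)) + pairing g2 (the (D y)) = pairing f2 y"
      by (simp add: pairing_zero_right domIff)
  qed
  moreover have ?M if R: ?R
  proof (intro ballI)
    fix x y assume "x \<in> dom A \<inter> dom C" "y \<in> dom B \<inter> dom D"
    with R have "pairing g1 (the (A x)) + pairing g2 (the (C x)) = pairing f1 x"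
      "pairing g1 (the (B y)) + pairing g2 (the (D y)) = pairing f2 y"
      by blast+
    then show "pairing g1 (the (A x)) + pairing g1 (the (B y)) +
      (pairing g2 (the (C x)) + pairing g2 (the (D y))) = pairing f1 x + pairing f2 y"
      by (simp add: algebra_simps)
  qed
  ultimately show ?thesis
    using L by blast
qed

lemma adjoint_rel_restrict_iff:
  assumes "S \<subseteq> dom T"
  shows "adjoint_rel (T |` S) g f \<longleftrightarrow> (\<forall>x\<in>S. pairing g (the (T x)) = pairing f x)"
  using assms by (auto simp: adjoint_rel_def)

text \<open>The closure of a product is the product of the closures, and a product is the whole
  space only if both factors are.\<close>

lemma densely_defined_block_op_cols:
  assumes "densely_defined (block_op A B C D)"
  shows "closure (dom A \<inter> dom C) = UNIV" "closure (dom B \<inter> dom D) = UNIV"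
  using assms unfolding densely_defined_def dom_block_op closure_Times
  by (auto simp: set_eq_iff)

lemma densely_defined_restrict:
  assumes "closure S = UNIV" "S \<subseteq> dom T"
  shows "densely_defined (T |` S)"
  using assms by (simp add: densely_defined_def Int_absorb1)

theorem theorem2p2:
  fixes A :: "'a::complex_banach \<rightharpoonup> 'a"
    and B :: "'b::complex_banach \<rightharpoonup> 'a"
    and C :: "'a \<rightharpoonup> 'b"
    and D :: "'b \<rightharpoonup> 'b"
  assumes "linear_operator A" and "linear_operator B"
    and "linear_operator C" and "linear_operator D"
    and "densely_defined (block_op A B C D)"
  shows "formal_adjoint A B C D = adjoint_prod (block_op A B C D) \<longleftrightarrow>
    has_matrix_representation (adjoint_prod (block_op A B C D))"
proof -
  let ?D1 = "dom A \<inter> dom C" and ?D2 = "dom B \<inter> dom D"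
  let ?F = "formal_adjoint A B C D" and ?S = "adjoint_prod (block_op A B C D)"
  note dense = densely_defined_block_op_cols[OF assms(5)]
  have dd: "densely_defined (A |` ?D1)" "densely_defined (C |` ?D1)"
    "densely_defined (B |` ?D2)" "densely_defined (D |` ?D2)"
    by (rule densely_defined_restrict[OF dense(1)] densely_defined_restrict[OF dense(2)]; blast)+
  have F: "?F = block_op (adjoint (A |` ?D1)) (adjoint (C |` ?D1))
      (adjoint (B |` ?D2)) (adjoint (D |` ?D2))"
    by (simp add: formal_adjoint_def Let_def)
  \<comment> \<open>Each entry is restricted to the common domain of its column, so these conditions
    range over the same vectors as the column identities in \<open>S\<close> below.\<close>
  have entries:
    "adjoint (A |` ?D1) g1 = Some f1 \<longleftrightarrow> (\<forall>x\<in>?D1. pairing g1 (the (A x)) = pairing f1 x)"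
    "adjoint (C |` ?D1) g2 = Some f1 \<longleftrightarrow> (\<forall>x\<in>?D1. pairing g2 (the (C x)) = pairing f1 x)"
    "adjoint (B |` ?D2) g1 = Some f2 \<longleftrightarrow> (\<forall>y\<in>?D2. pairing g1 (the (B y)) = pairing f2 y)"
    "adjoint (D |` ?D2) g2 = Some f2 \<longleftrightarrow> (\<forall>y\<in>?D2. pairing g2 (the (D y)) = pairing f2 y)"
    for g1 g2 f1 f2
    by (simp_all only: adjoint_eq_Some_iff dd adjoint_rel_restrict_iff inf_le1 inf_le2)
  have S: "?S (g1, g2) = Some (f1, f2) \<longleftrightarrow>
      (\<forall>x\<in>?D1. pairing g1 (the (A x)) + pairing g2 (the (C x)) = pairing f1 x) \<and>
      (\<forall>y\<in>?D2. pairing g1 (the (B y)) + pairing g2 (the (D y)) = pairing f2 y)"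
    for g1 g2 f1 f2
    by (simp only: adjoint_prod_eq_Some_iff[OF assms(5)] adjoint_rel_block_op_iff[OF assms(1-4)])
  \<comment> \<open>Here \<open>f1\<close> is the sum of the values of the adjoints of
    \<open>A\<close> and \<open>C\<close>, and \<open>f2\<close> that of \<open>B\<close> and
    \<open>D\<close>; adding the entry identities within each column gives \<open>S\<close>.\<close>
  have F_le_S: "?S (g1, g2) = Some (f1, f2)" if "?F (g1, g2) = Some (f1, f2)" for g1 g2 f1 f2
    using that unfolding F block_op_eq_Some_iff entries S
    by (elim exE conjE) (simp only: prod.inject pairing_add_left simp_thms ball_triv cong: ball_cong)
  have "?F = ?S" if rep: "has_matrix_representation ?S"
  proof -
    obtain P Q R T where lin: "linear_operator P" "linear_operator Q" "linear_operator R"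
      "linear_operator T" and S_eq: "?S = block_op P Q R T"
      using rep unfolding has_matrix_representation_def by blast
    \<comment> \<open>With 0 in all four domains, the product domain contains \<open>(g1, 0)\<close>
      and \<open>(0, g2)\<close> along with \<open>(g1, g2)\<close>.\<close>
    have zero: "0 \<in> dom P" "0 \<in> dom Q" "0 \<in> dom R" "0 \<in> dom T"
      using lin[THEN linear_operator_zero] by (simp_all only: domI)
    have S_dom: "(g1, g2) \<in> dom ?F" if "(g1, g2) \<in> dom ?S" for g1 g2
    proof -
      have "(g1, 0) \<in> dom ?S" "(0, g2) \<in> dom ?S"
        using that zero unfolding S_eq dom_block_op by blast+
      then obtain a b c d where "?S (g1, 0) = Some (a, b)" "?S (0, g2) = Some (c, d)"
        by (auto simp: dom_def)
      \<comment> \<open>When one component is 0, only one term survives on the left of each column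
        identity, and what remains is the criterion in \<open>entries\<close>.\<close>
      then have "adjoint (A |` ?D1) g1 = Some a" "adjoint (B |` ?D2) g1 = Some b"
        "adjoint (C |` ?D1) g2 = Some c" "adjoint (D |` ?D2) g2 = Some d"
        unfolding S entries pairing_zero_left add_0_left add_0_right by blast+
      then show ?thesis
        unfolding F dom_block_op by blast
    qed
    show ?thesis
    \<comment> \<open>Equality is pointwise: where \<open>?F\<close> is defined,
      \<open>F_le_S\<close> gives the same value for \<open>?S\<close>; elsewhere
      \<open>S_dom\<close> makes \<open>?S\<close> undefined too.\<close>
    proof
      fix g
      show "?F g = ?S g"
      proof (cases "?F g")
        case None
        then have "g \<notin> dom ?S"
          using S_dom by (cases g) blast
        then show ?thesis
          unfolding None domIff not_not by (rule sym)
      next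
        case (Some f)
        then have "?S g = Some f"
          using F_le_S by (cases g; cases f) blast
        then show ?thesis
          unfolding Some by (rule sym)
      qed
    qed
  qed
  \<comment> \<open>This settles the forward direction: if \<open>?S\<close> equals
    \<open>?F\<close>, it inherits the representation of \<open>?F\<close> by linear
    entries.\<close>
  moreover have "has_matrix_representation ?F"
    unfolding F by (rule has_matrix_representation_block_op; rule linear_operator_adjoint; rule dd)
  ultimately show ?thesis
    by metis
qed

end
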